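(* For every positive integer $N$, the map $T_N$ has a unique ergodic invariant probability measure on $I=[0,1)$ that is absolutely continuous with respect to Lebesgue measure $m$, and this measure is the measure $\mu_N$ given by $$d\mu_N(x)=\frac{1}{\ln(N+1)-\ln N}\cdot\frac{1}{N+x}\,dm(x).$$
   Context: $m$ denotes Lebesgue measure on $I=[0,1)$, and $\{y\}$ denotes the fractional part of a real number $y$. For a positive integer $N$, the generalized Gauss transformation $T_N:I\to I$ is defined by $T_N(0)=0$ and $T_N(x)=\{N/x\}$ for $x\ne 0$. *)

theory Defs
  imports "HOL-Probability.Probability"
begin

definition gauss_map :: "nat \<Rightarrow> real \<Rightarrow> real" where
  "gauss_map N x = (if x = 0 then 0 else frac (real N / x))"

text \<open>Lebesgue measure on the Borel sets of $[0,1)$.\<close>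

definition leb_I :: "real measure" where
  "leb_I = restrict_space lborel {0..<1}"

definition invariant_measure :: "('a \<Rightarrow> 'a) \<Rightarrow> 'a measure \<Rightarrow> bool" where
  "invariant_measure T M \<longleftrightarrow>
     T \<in> measurable M M \<and> (\<forall>A\<in>sets M. emeasure M (T -` A \<inter> space M) = emeasure M A)"

definition ergodic_measure :: "('a \<Rightarrow> 'a) \<Rightarrow> 'a measure \<Rightarrow> bool" where
  "ergodic_measure T M \<longleftrightarrow>
     (\<forall>A\<in>sets M. T -` A \<inter> space M = A \<longrightarrow>
        emeasure M A = 0 \<or> emeasure M (space M - A) = 0)"

text \<open>
  The condition on \<open>sets \<mu>\<close> says that \<open>\<mu>\<close> is a Borel measure on $[0,1)$. It is needed
  separately, since \<^term>\<open>absolutely_continuous leb_I \<mu>\<close> (that is, \<open>\<mu>\<close> is absolutely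
  continuous with respect to Lebesgue measure) does not constrain the sigma-algebra of \<open>\<mu>\<close>.
\<close>

definition acim_ergodic :: "nat \<Rightarrow> real measure \<Rightarrow> bool" where
  "acim_ergodic N \<mu> \<longleftrightarrow>
     sets \<mu> = sets leb_I \<and> prob_space \<mu> \<and>
     invariant_measure (gauss_map N) \<mu> \<and> ergodic_measure (gauss_map N) \<mu> \<and>
     absolutely_continuous leb_I \<mu>"

definition gauss_measure :: "nat \<Rightarrow> real measure" where
  "gauss_measure N =
     density leb_I (\<lambda>x. ennreal (1 / (ln (real N + 1) - ln (real N)) * (1 / (real N + x))))"

end

theory Submission
  imports Defs "HOL-Real_Asymp.Real_Asymp"
begin

text \<open>
  Write \<open>T\<close> for the Gauss map with parameter \<open>N\<close>, \<open>M\<close> for the Gauss measure and \<open>L\<close> for the transfer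
  operator of \<open>T\<close> relative to \<open>M\<close>, so that \<open>\<integral> \<phi>(T x) g(x) dM = \<integral> \<phi>(x) L g(x) dM\<close>. The inverse branches
  of \<open>T\<close> are \<open>x \<mapsto> N / (N + k + x)\<close>, and \<open>L g(x)\<close> is the average of \<open>g\<close> over the preimages of \<open>x\<close> with
  weights \<open>(N + x) / ((N + k + x) (N + k + 1 + x))\<close>. These weights telescope to sum 1, that is
  \<open>L 1 = 1\<close>, and by duality this is the invariance of \<open>M\<close>.

  The heart of the proof is a contraction on monotone functions. If \<open>g\<close> is increasing on \<open>[0,1]\<close>,
  then \<open>L g\<close> is decreasing (\<open>transfer_antimono\<close>), and matching the preimages of 0 with those of 1
  gives \<open>L g(0) - L g(1) \<le> (g(1) - g(0)) / (N + 1)\<close> (\<open>transfer_oscillation\<close>). Hence \<open>L\<^sup>n g\<close>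
  converges uniformly to a constant, which must be \<open>\<integral> g dM\<close>, and duality yields
  \<open>\<integral> 1\<^sub>A(T\<^sup>n x) g(x) dM \<longlonglongrightarrow> M(A) \<integral> g dM\<close> for every Borel set \<open>A\<close>. Applied to indicators of rays,
  this extends to all integrable \<open>g\<close> by a pi-lambda argument and \<open>L\<^sup>1\<close> approximation
  (\<open>gauss_map_mixing\<close>).

  Both remaining claims are read off from that limit. If \<open>A\<close> is invariant, then \<open>g = 1\<^sub>A\<close> gives
  \<open>M(A) = M(A)\<^sup>2\<close>, so \<open>M\<close> is ergodic. If \<open>\<mu> = D M\<close> is an invariant probability measure, then
  \<open>g = D\<close> makes the left-hand side constantly \<open>\<mu>(A)\<close>, so \<open>\<mu>(A) = M(A)\<close>.
\<close>

section \<open>The transfer operator\<close>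

text \<open>
  The conditional probability of \<open>\<lfloor>N / y\<rfloor> = N + k\<close> given \<open>T y = x\<close>, for \<open>y\<close> distributed according to
  the Gauss measure. Branches are indexed from \<open>N\<close> because \<open>N / y > N\<close> for \<open>0 < y < 1\<close>.
\<close>

definition branch_weight :: "nat \<Rightarrow> nat \<Rightarrow> real \<Rightarrow> real" where
  "branch_weight N k x = (N + x) / ((real N + real k + x) * (real N + real k + 1 + x))"

definition transfer_op :: "nat \<Rightarrow> (real \<Rightarrow> real) \<Rightarrow> real \<Rightarrow> real" where
  "transfer_op N g x = (\<Sum>k. branch_weight N k x * g (N / (real N + real k + x)))"

lemma inverse_branch_in_unit:
  assumes "N \<ge> 1" "x \<in> {0..1}"
  shows "real N / (real N + real k + x) \<in> {0..1}"
  using assms by (auto simp: field_simps)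

lemma branch_weight_nonneg:
  assumes "N \<ge> 1" "x \<in> {0..1}"
  shows "branch_weight N k x \<ge> 0"
  using assms by (auto simp: branch_weight_def)

text \<open>
  Partial fractions. Partial sums and tails of the weights are thereby explicit, which gives both
  the total weight 1 and the stochastic dominance between the weights at different points.
\<close>

lemma branch_weight_telescope:
  assumes "N \<ge> 1" "x \<in> {0..1}"
  shows "branch_weight N k x = (N + x) / (real N + real k + x) - (N + x) / (real N + real (Suc k) + x)"
proof -
  have "real N + real k + x > 0" using assms by auto
  moreover have "real N + real k + 1 + x > 0" using assms by auto
  ultimately show ?thesis
    unfolding branch_weight_def by (simp add: divide_simps) (simp add: algebra_simps)
qed

lemma sum_branch_weight:
  assumes "N \<ge> 1" "x \<in> {0..1}"
  shows "(\<Sum>k<n. branch_weight N k x) = 1 - (N + x) / (real N + real n + x)"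
proof (induction n)
  case 0
  have "real N + x > 0" using assms by auto
  then show ?case by simp
next
  case (Suc n)
  then show ?case using branch_weight_telescope[OF assms, of n] by simp
qed

lemma branch_weight_sums:
  assumes "N \<ge> 1" "x \<in> {0..1}"
  shows "(\<lambda>k. branch_weight N k x) sums 1"
proof -
  have "(\<lambda>n. 1 - (N + x) / (N + real n + x)) \<longlonglongrightarrow> 1 - 0"
    by real_asymp
  then show ?thesis
    unfolding sums_def using sum_branch_weight[OF assms] by simp
qed

lemma transfer_summable:
  assumes "N \<ge> 1" "x \<in> {0..1}" and g: "\<And>y. y \<in> {0..1} \<Longrightarrow> g y \<in> {0..1}"
  shows "summable (\<lambda>k. branch_weight N k x * g (N / (real N + real k + x)))"
proof (rule summable_comparison_test')
  show "summable (\<lambda>k. branch_weight N k x)"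
    using branch_weight_sums[OF assms(1,2)] by (rule sums_summable)
  fix k
  show "norm (branch_weight N k x * g (N / (real N + real k + x))) \<le> branch_weight N k x"
    using g[OF inverse_branch_in_unit[OF assms(1,2), of k]] branch_weight_nonneg[OF assms(1,2), of k]
    by (auto simp: abs_mult intro: mult_left_le)
qed

lemma transfer_sums:
  assumes "N \<ge> 1" "x \<in> {0..1}" "\<And>y. y \<in> {0..1} \<Longrightarrow> g y \<in> {0..1}"
  shows "(\<lambda>k. branch_weight N k x * g (N / (real N + real k + x))) sums transfer_op N g x"
  using summable_sums[OF transfer_summable[OF assms]] by (simp add: transfer_op_def)

lemma transfer_one:
  assumes "N \<ge> 1" "x \<in> {0..1}"
  shows "transfer_op N (\<lambda>_. 1) x = 1"
  using branch_weight_sums[OF assms] by (simp add: transfer_op_def sums_iff)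

text \<open>
  Reflecting values by \<open>g \<mapsto> 1 - g\<close> swaps increasing and decreasing functions while staying inside
  \<open>[0,1]\<close>, so results for increasing functions transfer to decreasing ones.
\<close>

lemma transfer_complement:
  assumes "N \<ge> 1" "x \<in> {0..1}" and g: "\<And>y. y \<in> {0..1} \<Longrightarrow> g y \<in> {0..1}"
  shows "transfer_op N (\<lambda>y. 1 - g y) x = 1 - transfer_op N g x"
proof -
  have "(\<lambda>k. branch_weight N k x - branch_weight N k x * g (N / (real N + real k + x)))
          sums (1 - transfer_op N g x)"
    by (intro sums_diff branch_weight_sums transfer_sums assms)
  then show ?thesis
    by (simp add: transfer_op_def sums_iff right_diff_distrib)
qed

lemma transfer_in_unit:
  assumes "N \<ge> 1" "x \<in> {0..1}" and g: "\<And>y. y \<in> {0..1} \<Longrightarrow> g y \<in> {0..1}"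
  shows "transfer_op N g x \<in> {0..1}"
proof -
  have nonneg: "transfer_op N g x \<ge> 0" if "\<And>y. y \<in> {0..1} \<Longrightarrow> g y \<in> {0..1::real}" for g
    unfolding transfer_op_def
    using that inverse_branch_in_unit[OF assms(1,2)]
    by (intro suminf_nonneg transfer_summable assms mult_nonneg_nonneg branch_weight_nonneg) auto
  show ?thesis
    using nonneg[of g] nonneg[of "\<lambda>y. 1 - g y"] transfer_complement[OF assms(1,2), of g] g by auto
qed

lemma transfer_measurable:
  assumes [measurable]: "g \<in> borel_measurable borel"
  shows "transfer_op N g \<in> borel_measurable borel"
  unfolding transfer_op_def[abs_def] branch_weight_def[abs_def] by measurable

text \<open>
  Abel summation in one-sided form: replacing \<open>u n\<close> by the smaller \<open>u (Suc n)\<close> only increases the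
  bound, as the partial sums of \<open>d\<close> are nonpositive. For \<open>u \<ge> 0\<close> the sum is hence nonpositive.
\<close>

lemma sum_mult_decseq_le_0:
  fixes d u :: "nat \<Rightarrow> real"
  assumes D: "\<And>n. sum d {..<n} \<le> 0" and u: "decseq u"
  shows "(\<Sum>k<n. d k * u k) \<le> sum d {..<n} * u n"
proof (induction n)
  case (Suc n)
  have "(\<Sum>k<Suc n. d k * u k) \<le> sum d {..<Suc n} * u n"
    using Suc by (simp add: algebra_simps)
  also have "\<dots> \<le> sum d {..<Suc n} * u (Suc n)"
    using D[of "Suc n"] u by (intro mult_left_mono_neg) (auto simp: decseq_Suc_iff)
  finally show ?case .
qed simp

section \<open>Contraction on monotone functions\<close>

text \<open>
  Two effects act in the same direction when \<open>x\<close> grows: each preimage \<open>N / (N + k + x)\<close> moves left,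
  and the weights move towards larger \<open>k\<close>, that is towards smaller preimages. The second effect
  is stochastic dominance, expressed by the sign of the partial sums of the weight differences.
\<close>

lemma transfer_antimono:
  assumes N: "N \<ge> 1" and g: "\<And>y. y \<in> {0..1} \<Longrightarrow> g y \<in> {0..1}" and mono: "mono_on {0..1} g"
  shows "antimono_on {0..1} (transfer_op N g)"
proof (rule monotone_onI)
  fix x x' :: real
  assume x: "x \<in> {0..1}" and x': "x' \<in> {0..1}" and le: "x \<le> x'"
  \<comment> \<open>Move the weights from \<open>x\<close> to \<open>x'\<close> while the preimages of \<open>x\<close> are kept fixed.\<close>
  define u where "u = (\<lambda>k::nat. g (N / (real N + real k + x)))"
  define d where "d = (\<lambda>k. branch_weight N k x' - branch_weight N k x)"
  have u01: "u k \<in> {0..1}" for k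
    unfolding u_def by (intro g inverse_branch_in_unit N x)
  have "decseq u"
    unfolding decseq_def u_def
    using inverse_branch_in_unit[OF N x] N x
    by (auto intro!: mono_onD[OF mono] divide_left_mono mult_pos_pos)
  have D: "sum d {..<n} \<le> 0" for n
  proof -
    have "(N + x) / (real N + real n + x) \<le> (N + x') / (real N + real n + x')"
      using N x x' le by (simp add: field_simps add_pos_nonneg)
                         (simp add: mult_right_mono)
    then show ?thesis
      using sum_branch_weight[OF N x, of n] sum_branch_weight[OF N x', of n]
      by (simp add: d_def sum_subtractf)
  qed
  have sm: "summable (\<lambda>k. branch_weight N k z * u k)" if "z \<in> {0..1}" for z
  proof (rule summable_comparison_test')
    show "summable (\<lambda>k. branch_weight N k z)"
      using branch_weight_sums[OF N that] by (rule sums_summable)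
    show "norm (branch_weight N k z * u k) \<le> branch_weight N k z" for k
      using u01[of k] branch_weight_nonneg[OF N that, of k]
      by (auto simp: abs_mult intro: mult_left_le)
  qed
  have "transfer_op N g x' \<le> (\<Sum>k. branch_weight N k x' * u k)"
    unfolding transfer_op_def u_def
    using inverse_branch_in_unit[OF N x] inverse_branch_in_unit[OF N x'] N x le
    by (intro suminf_le mult_left_mono branch_weight_nonneg N x' mono_onD[OF mono]
          transfer_summable g sm[unfolded u_def] divide_left_mono mult_pos_pos) auto
  also have "(\<Sum>k. branch_weight N k x' * u k) - (\<Sum>k. branch_weight N k x * u k) \<le> 0"
  proof -
    have "(\<Sum>k<n. d k * u k) \<le> 0" for n
      using sum_mult_decseq_le_0[OF D \<open>decseq u\<close>, of n] mult_nonpos_nonneg[OF D, of "u n" n] u01[of n]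
      by simp
    moreover have "(\<lambda>k. d k * u k) sums ((\<Sum>k. branch_weight N k x' * u k) - (\<Sum>k. branch_weight N k x * u k))"
      unfolding d_def left_diff_distrib
      by (intro sums_diff summable_sums sm x x')
    ultimately show ?thesis
      unfolding sums_def by (intro LIMSEQ_le_const2[where X = "\<lambda>n. \<Sum>k<n. d k * u k"]) auto
  qed
  then have "(\<Sum>k. branch_weight N k x' * u k) \<le> transfer_op N g x"
    by (simp add: transfer_op_def u_def)
  finally show "transfer_op N g x \<ge> transfer_op N g x'" .
qed

text \<open>
  The preimages of 1 are exactly those preimages of 0 other than 1 itself. With
  \<open>v k = 1 / ((N + k + 1) (N + k + 2))\<close> the common points \<open>N / (N + k + 1)\<close> have weight \<open>N v k\<close> over 0
  and \<open>(N + 1) v k\<close> over 1, so the difference of the two averages is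
  \<open>g(1) / (N + 1) - \<Sum> v k g(N / (N + k + 1))\<close>, where the \<open>v k\<close> have sum \<open>1 / (N + 1)\<close>.
\<close>

lemma transfer_oscillation:
  assumes N: "N \<ge> 1" and g: "\<And>y. y \<in> {0..1} \<Longrightarrow> g y \<in> {0..1}" and mono: "mono_on {0..1} g"
  shows "transfer_op N g 0 - transfer_op N g 1 \<le> (g 1 - g 0) / (real N + 1)"
proof -
  define v where "v = (\<lambda>k. 1 / (real N + real (Suc k)) - 1 / (real N + real (Suc (Suc k))) :: real)"
  define y where "y = (\<lambda>k. real N / (real N + real (Suc k)))"
  have y01: "y k \<in> {0..1}" for k by (auto simp: y_def field_simps)
  have v0: "v k \<ge> 0" for k by (simp add: v_def field_simps)
  have vs: "v sums (1 / (real N + 1))"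
  proof -
    have "(\<lambda>k. 1 / (real N + real k + 1)) \<longlonglongrightarrow> 0" by real_asymp
    from telescope_sums'[OF this] show ?thesis by (simp add: v_def add_ac)
  qed
  have w0: "branch_weight N (Suc k) 0 = N * v k" for k
    using branch_weight_telescope[OF N, of 0 "Suc k"]
    by (simp add: v_def algebra_simps)
  have b0: "branch_weight N 0 0 = 1 / (real N + 1)"
    using N by (simp add: branch_weight_def)
  have w1: "branch_weight N k 1 = (real N + 1) * v k" for k
    using branch_weight_telescope[OF N, of 1 k]
    by (simp add: v_def algebra_simps)
  have "(\<lambda>k. branch_weight N (Suc k) 0 * g (N / (real N + real (Suc k) + 0))) sums
          (transfer_op N g 0 - branch_weight N 0 0 * g (N / (real N + real 0 + 0)))"
    using transfer_sums[where g=g, OF N _ g, of 0]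
    by (subst sums_Suc_iff) simp
  then have s0: "(\<lambda>k. N * v k * g (y k)) sums (transfer_op N g 0 - g 1 / (real N + 1))"
    unfolding w0 b0 using N by (simp add: y_def)
  have "(\<lambda>k. branch_weight N k 1 * g (N / (real N + real k + 1))) sums transfer_op N g 1"
    using transfer_sums[where g=g, OF N _ g, of 1] by simp
  then have s1: "(\<lambda>k. (real N + 1) * v k * g (y k)) sums transfer_op N g 1"
    by (simp add: w1 y_def add_ac)
  have s: "(\<lambda>k. v k * g (y k)) sums (transfer_op N g 1 - (transfer_op N g 0 - g 1 / (real N + 1)))"
    using sums_diff[OF s1 s0] by (simp add: algebra_simps)
  have s': "(\<lambda>k. v k * g 0) sums (1 / (real N + 1) * g 0)"
    by (intro sums_mult2 vs)
  have le: "v k * g 0 \<le> v k * g (y k)" for k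
    using y01[of k] v0[of k] by (intro mult_left_mono mono_onD[OF mono]) auto
  have "1 / (real N + 1) * g 0 \<le> transfer_op N g 1 - (transfer_op N g 0 - g 1 / (real N + 1))"
    by (rule sums_le[OF le s' s])
  then show ?thesis by (simp add: diff_divide_distrib)
qed

text \<open>
  For a monotone function the difference of the values at the endpoints is the oscillation, so the
  class of such functions is preserved by the transfer operator with a smaller \<open>r\<close> at each step.
  Both directions of monotonicity are admitted because the operator reverses the direction.
\<close>

definition unit_osc :: "real \<Rightarrow> (real \<Rightarrow> real) \<Rightarrow> bool" where
  "unit_osc r g \<longleftrightarrow> g \<in> borel_measurable borel \<and> (\<forall>y\<in>{0..1}. g y \<in> {0..1}) \<and>
     (mono_on {0..1} g \<or> antimono_on {0..1} g) \<and> \<bar>g 1 - g 0\<bar> \<le> r"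

lemma unit_osc_transfer_mono:
  assumes N: "N \<ge> 1" and g: "unit_osc r g" and mono: "mono_on {0..1} g"
  shows "unit_osc (r / (real N + 1)) (transfer_op N g)" "antimono_on {0..1} (transfer_op N g)"
proof -
  have g01: "\<And>y. y \<in> {0..1} \<Longrightarrow> g y \<in> {0..1}" and [measurable]: "g \<in> borel_measurable borel"
    using g by (auto simp: unit_osc_def)
  show anti: "antimono_on {0..1} (transfer_op N g)"
    by (rule transfer_antimono[OF N g01 mono])
  have "transfer_op N g 1 \<le> transfer_op N g 0"
    using monotone_onD[OF anti, of 0 1] by simp
  moreover have "g 1 - g 0 \<le> r" using g by (auto simp: unit_osc_def)
  then have "(g 1 - g 0) / (real N + 1) \<le> r / (real N + 1)" by (simp add: divide_right_mono)
  ultimately have "\<bar>transfer_op N g 1 - transfer_op N g 0\<bar> \<le> r / (real N + 1)"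
    using transfer_oscillation[OF N g01 mono] by simp
  then show "unit_osc (r / (real N + 1)) (transfer_op N g)"
    using anti transfer_measurable[of g N] transfer_in_unit[OF N _ g01]
    by (simp add: unit_osc_def)
qed

lemma unit_osc_transfer:
  assumes N: "N \<ge> 1" and g: "unit_osc r g"
  shows "unit_osc (r / (real N + 1)) (transfer_op N g)"
proof (cases "mono_on {0..1} g")
  case True
  then show ?thesis by (rule unit_osc_transfer_mono(1)[OF N g])
next
  case False
  define h where "h = (\<lambda>y. 1 - g y)"
  have g01: "\<And>y. y \<in> {0..1} \<Longrightarrow> g y \<in> {0..1}" using g by (auto simp: unit_osc_def)
  have h_mono: "mono_on {0..1} h"
    using g False by (auto simp: h_def unit_osc_def monotone_on_def)
  have h: "unit_osc r h"
    using g h_mono by (auto simp: unit_osc_def h_def)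
  have eq: "transfer_op N g x = 1 - transfer_op N h x" if "x \<in> {0..1}" for x
    using transfer_complement[OF N that g01] by (simp add: h_def)
  have "mono_on {0..1} (transfer_op N g)"
    using unit_osc_transfer_mono(2)[OF N h h_mono] eq by (auto simp: monotone_on_def)
  then show ?thesis
    using unit_osc_transfer_mono(1)[OF N h h_mono] eq[of 0] eq[of 1]
      transfer_in_unit[OF N _ g01] transfer_measurable[of g N] g
    by (auto simp: unit_osc_def)
qed

lemma unit_osc_transfer_iterate:
  assumes N: "N \<ge> 1" and g: "unit_osc 1 g"
  shows "unit_osc ((1 / (real N + 1)) ^ n) ((transfer_op N ^^ n) g)"
proof (induction n)
  case (Suc n)
  from unit_osc_transfer[OF N this] show ?case by simp
qed (use g in simp)

section \<open>Duality between the map and the transfer operator\<close>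

text \<open>
  Change of variables \<open>x = c / (a + y)\<close> on one branch. The substitution rule is for increasing
  functions, so the branch is composed with the reflection \<open>y = 1 - z\<close>.
\<close>

lemma nn_integral_branch:
  fixes F :: "real \<Rightarrow> real" and a c :: real
  assumes a: "a > 0" and c: "c > 0" and [measurable]: "F \<in> borel_measurable borel"
  shows "(\<integral>\<^sup>+x. ennreal (F x * indicator {c / (a + 1)..c / a} x) \<partial>lborel) =
         (\<integral>\<^sup>+y. ennreal (F (c / (a + y)) * (c / (a + y)\<^sup>2) * indicator {0..1} y) \<partial>lborel)"
proof -
  define G where "G = (\<lambda>z. c / (a + 1 - z))"
  define G' where "G' = (\<lambda>z. c / (a + 1 - z)\<^sup>2)"
  have "(\<integral>\<^sup>+x. ennreal (F x * indicator {G 0..G 1} x) \<partial>lborel) =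
        (\<integral>\<^sup>+z. ennreal (F (G z) * G' z * indicator {0..1} z) \<partial>lborel)"
  proof (rule nn_integral_substitution)
    show "set_borel_measurable borel {G 0..G 1} F"
      by (simp add: set_borel_measurable_def)
    show "(G has_real_derivative G' z) (at z)" if "z \<in> {0..1}" for z
      unfolding G_def G'_def using that a
      by (auto intro!: derivative_eq_intros simp: power2_eq_square)
    show "continuous_on {0..1} G'"
      unfolding G'_def using a by (intro continuous_intros) auto
    show "G' z \<ge> 0" if "z \<in> {0..1}" for z
      unfolding G'_def using that c by simp
  qed simp
  also have "\<dots> = (\<integral>\<^sup>+y. ennreal (F (c / (a + y)) * (c / (a + y)\<^sup>2) * indicator {0..1} (1 - y)) \<partial>lborel)"
    by (subst nn_integral_real_affine[where c = "-1" and t = 1]) (auto simp: G_def G'_def algebra_simps)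
  also have "\<dots> = (\<integral>\<^sup>+y. ennreal (F (c / (a + y)) * (c / (a + y)\<^sup>2) * indicator {0..1} y) \<partial>lborel)"
    by (intro nn_integral_cong) (auto simp: indicator_def)
  finally show ?thesis by (simp add: G_def)
qed

text \<open>
  The branch intervals tile \<open>(0,1]\<close>. Closed intervals overlap at their endpoints and the
  tiling misses 0; these countably many points form a null set and are excluded.
\<close>

lemma indicator_unit_eq_suminf_branches:
  assumes N: "N \<ge> 1" and x: "x \<notin> insert 0 (range (\<lambda>k. real N / (real N + real k)))"
  shows "ennreal (r * indicator {0..<1} x) =
    (\<Sum>k. ennreal (r * indicator {N / (real N + real k + 1)..N / (real N + real k)} x))"
proof (cases "x \<in> {0..<1}")
  case False
  have "indicator {N / (real N + real k + 1)..N / (real N + real k)} x = (0::real)" for k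
  proof -
    have "N / (real N + real k) \<le> 1" "N / (real N + real k + 1) > 0" using N by (auto simp: field_simps)
    moreover have "x \<noteq> 1" using x N rangeI[of "\<lambda>k. real N / (real N + real k)" 0] by auto
    ultimately show ?thesis using False by (auto simp: indicator_def)
  qed
  with False show ?thesis by simp
next
  case True
  with x have x01: "0 < x" "x < 1" by auto
  define j where "j = nat \<lfloor>N / x\<rfloor> - N"
  have "N / x > N" using N x01 by (simp add: field_simps)
  then have j: "real N + real j = of_int \<lfloor>N / x\<rfloor>"
    unfolding j_def by (simp add: of_nat_diff le_nat_floor nat_le_iff le_floor_iff)
  have "(x \<in> {N / (real N + real k + 1)..N / (real N + real k)}) \<longleftrightarrow> k = j" for k
  proof -
    have "x \<noteq> N / (real N + real k)" "x \<noteq> N / (real N + real (Suc k))"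
      using x by (auto simp del: of_nat_Suc)
    then have "(x \<in> {N / (real N + real k + 1)..N / (real N + real k)}) \<longleftrightarrow>
         real N + real k \<le> N / x \<and> N / x < real N + real k + 1"
      using N x01 by (auto simp: field_simps)
    also have "\<dots> \<longleftrightarrow> \<lfloor>N / x\<rfloor> = int (N + k)"
      by (simp add: floor_eq_iff)
    also have "\<dots> \<longleftrightarrow> k = j" using j by linarith
    finally show ?thesis .
  qed
  then have "(\<Sum>k. ennreal (r * indicator {N / (real N + real k + 1)..N / (real N + real k)} x)) =
      (\<Sum>k. if k = j then ennreal r else 0)"
    by (intro suminf_cong) (simp add: indicator_def)
  also have "\<dots> = ennreal r"
    using sums_single[of j "\<lambda>_. ennreal r"] by (simp add: sums_iff)
  finally show ?thesis using True by simp
qed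

lemma nn_integral_unit_branches:
  fixes F :: "real \<Rightarrow> real"
  assumes N: "N \<ge> 1" and [measurable]: "F \<in> borel_measurable borel"
  shows "(\<integral>\<^sup>+x. ennreal (F x * indicator {0..<1} x) \<partial>lborel) =
    (\<integral>\<^sup>+y. (\<Sum>k. ennreal (F (N / (real N + real k + y)) * (N / (real N + real k + y)\<^sup>2)
        * indicator {0..<1} y)) \<partial>lborel)"
proof -
  have AE_avoid: "AE x in lborel. x \<notin> S" if "countable S" for S :: "real set"
    using that by (intro AE_not_in countable_imp_null_set_lborel)
  have "(\<integral>\<^sup>+x. ennreal (F x * indicator {0..<1} x) \<partial>lborel) =
     (\<integral>\<^sup>+x. (\<Sum>k. ennreal (F x * indicator {N / (real N + real k + 1)..N / (real N + real k)} x)) \<partial>lborel)"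
    using AE_avoid[of "insert 0 (range (\<lambda>k. real N / (real N + real k)))"]
    by (intro nn_integral_cong_AE)
       (auto elim: eventually_mono simp: indicator_unit_eq_suminf_branches[OF N] simp del: insert_iff)
  also have "\<dots> = (\<Sum>k. \<integral>\<^sup>+y. ennreal (F (N / (real N + real k + y)) * (N / (real N + real k + y)\<^sup>2)
        * indicator {0..1} y) \<partial>lborel)"
  proof (subst nn_integral_suminf)
    show "(\<Sum>k. \<integral>\<^sup>+x. ennreal (F x * indicator {N / (real N + real k + 1)..N / (real N + real k)} x) \<partial>lborel) =
       (\<Sum>k. \<integral>\<^sup>+y. ennreal (F (N / (real N + real k + y)) * (N / (real N + real k + y)\<^sup>2)
        * indicator {0..1} y) \<partial>lborel)"
      using N by (intro suminf_cong nn_integral_branch) simp_all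
  qed simp
  also have "\<dots> = (\<integral>\<^sup>+y. (\<Sum>k. ennreal (F (N / (real N + real k + y)) * (N / (real N + real k + y)\<^sup>2)
        * indicator {0..1} y)) \<partial>lborel)"
    by (subst nn_integral_suminf) auto
  also have "\<dots> = (\<integral>\<^sup>+y. (\<Sum>k. ennreal (F (N / (real N + real k + y)) * (N / (real N + real k + y)\<^sup>2)
        * indicator {0..<1} y)) \<partial>lborel)"
    using AE_avoid[of "{1}"]
    by (intro nn_integral_cong_AE) (auto elim!: eventually_mono simp: indicator_def intro!: suminf_cong)
  finally show ?thesis .
qed

definition gauss_density :: "nat \<Rightarrow> real \<Rightarrow> real" where
  "gauss_density N x = 1 / (ln (real N + 1) - ln (real N)) * (1 / (real N + x))"

lemma gauss_density_pos:
  assumes "N \<ge> 1" "x \<ge> 0"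
  shows "gauss_density N x > 0"
  using assms by (auto simp: gauss_density_def)

lemma gauss_density_measurable [measurable]: "gauss_density N \<in> borel_measurable borel"
  unfolding gauss_density_def[abs_def] by measurable

lemma space_gauss_measure [simp]: "space (gauss_measure N) = {0..<1}"
  by (simp add: gauss_measure_def leb_I_def space_restrict_space)

lemma sets_gauss_measure: "sets (gauss_measure N) = sets leb_I"
  by (simp add: gauss_measure_def)

lemma borel_measurable_leb_I: "f \<in> borel \<rightarrow>\<^sub>M M \<Longrightarrow> f \<in> leb_I \<rightarrow>\<^sub>M M"
  unfolding leb_I_def by (intro measurable_restrict_space1) simp

lemma borel_measurable_gauss_measure: "f \<in> borel \<rightarrow>\<^sub>M M \<Longrightarrow> f \<in> gauss_measure N \<rightarrow>\<^sub>M M"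
  using borel_measurable_leb_I by (simp cong: measurable_cong_sets add: sets_gauss_measure)

lemma nn_integral_gauss_measure:
  assumes N: "N \<ge> 1" and [measurable]: "F \<in> borel_measurable borel"
  shows "(\<integral>\<^sup>+x. ennreal (F x) \<partial>gauss_measure N) =
    (\<integral>\<^sup>+x. ennreal (gauss_density N x * F x * indicator {0..<1} x) \<partial>lborel)"
proof -
  have "(\<integral>\<^sup>+x. ennreal (F x) \<partial>gauss_measure N) =
      (\<integral>\<^sup>+x. ennreal (gauss_density N x) * ennreal (F x) \<partial>leb_I)"
    unfolding gauss_measure_def gauss_density_def[symmetric]
    by (intro nn_integral_density borel_measurable_leb_I) measurable
  also have "\<dots> = (\<integral>\<^sup>+x. ennreal (gauss_density N x) * ennreal (F x) * indicator {0..<1} x \<partial>lborel)"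
    unfolding leb_I_def by (intro nn_integral_restrict_space) simp
  also have "\<dots> = (\<integral>\<^sup>+x. ennreal (gauss_density N x * F x * indicator {0..<1} x) \<partial>lborel)"
    using gauss_density_pos[OF N]
    by (intro nn_integral_cong) (auto simp: indicator_def ennreal_mult' less_imp_le)
  finally show ?thesis .
qed

lemma prob_space_gauss_measure:
  assumes N: "N \<ge> 1"
  shows "prob_space (gauss_measure N)"
proof (rule prob_spaceI)
  define C where "C = ln (real N + 1) - ln (real N)"
  have C: "C > 0" using N by (simp add: C_def)
  have "(\<integral>\<^sup>+x. ennreal (gauss_density N x) * indicator {0..1} x \<partial>lborel) =
     ennreal (ln (real N + 1) / C - ln (real N + 0) / C)"
  proof (rule nn_integral_FTC_Icc[where F = "\<lambda>x. ln (real N + x) / C"])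
    show "DERIV (\<lambda>x. ln (real N + x) / C) x :> gauss_density N x" if "x \<in> {0..1}" for x
      using that N
      by (auto intro!: derivative_eq_intros simp: gauss_density_def C_def)
  qed (use gauss_density_pos[OF N] in \<open>auto simp: less_imp_le\<close>)
  also have "\<dots> = 1"
    using C by (simp add: C_def flip: diff_divide_distrib)
  finally have 1: "(\<integral>\<^sup>+x. ennreal (gauss_density N x) * indicator {0..1} x \<partial>lborel) = 1" .
  have "emeasure (gauss_measure N) (space (gauss_measure N)) = (\<integral>\<^sup>+x. ennreal 1 \<partial>gauss_measure N)"
    by simp
  also have "\<dots> = (\<integral>\<^sup>+x. ennreal (gauss_density N x) * indicator {0..1} x \<partial>lborel)"
    unfolding nn_integral_gauss_measure[OF N borel_measurable_const]
    using AE_lborel_singleton[of 1]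
    by (intro nn_integral_cong_AE) (auto elim!: eventually_mono simp: indicator_def)
  finally show "emeasure (gauss_measure N) (space (gauss_measure N)) = 1" using 1 by simp
qed

lemma gauss_map_measurable_borel [measurable]: "gauss_map N \<in> borel_measurable borel"
  unfolding gauss_map_def[abs_def] frac_def by measurable

lemma gauss_map_measurable: "gauss_map N \<in> gauss_measure N \<rightarrow>\<^sub>M gauss_measure N"
proof -
  have "gauss_map N \<in> leb_I \<rightarrow>\<^sub>M leb_I"
    unfolding leb_I_def
    by (intro measurable_restrict_space2 measurable_restrict_space1)
       (auto simp: gauss_map_def frac_lt_1)
  then show ?thesis by (simp cong: measurable_cong_sets add: sets_gauss_measure)
qed

lemma gauss_map_branch:
  assumes "N \<ge> 1" "y \<in> {0..<1}"
  shows "gauss_map N (N / (real N + real k + y)) = y"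
proof -
  have "frac (real N + real k + y) = y"
    using assms by (simp add: frac_unique_iff Ints_add)
  then show ?thesis using assms by (simp add: gauss_map_def add_nonneg_eq_0_iff)
qed

text \<open>
  The weights are determined by this identity: the density at the preimage times the derivative of
  the branch is the density at \<open>y\<close> times the weight of the branch.
\<close>

lemma gauss_density_branch:
  assumes "N \<ge> 1" "y \<in> {0..<1}"
  shows "gauss_density N (N / (real N + real k + y)) * (N / (real N + real k + y)\<^sup>2) =
     gauss_density N y * branch_weight N k y"
proof -
  define a where "a = real N + real k + y"
  define C where "C = 1 / (ln (real N + 1) - ln (real N))"
  have a: "a > 0" "real N > 0" "real N + y > 0" using assms by (auto simp: a_def)
  have "1 / (N + N / a) * (N / a\<^sup>2) = 1 / (N + y) * ((N + y) / (a * (a + 1)))"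
  proof -
    have "N + N / a = N * (a + 1) / a" using a by (simp add: field_simps)
    then show ?thesis using a by (simp add: power2_eq_square)
  qed
  then have "C * (1 / (N + N / a)) * (N / a\<^sup>2) = C * (1 / (N + y)) * ((N + y) / (a * (a + 1)))"
    by (simp only: mult.assoc)
  then show ?thesis
    unfolding gauss_density_def branch_weight_def C_def[symmetric] a_def by (simp only: add_ac)
qed

lemma transfer_dual:
  assumes N: "N \<ge> 1" and [measurable]: "\<phi> \<in> borel_measurable borel" "g \<in> borel_measurable borel"
    and \<phi>: "\<And>x. \<phi> x \<ge> 0" and g: "\<And>y. y \<in> {0..1} \<Longrightarrow> g y \<in> {0..1}"
  shows "(\<integral>\<^sup>+x. ennreal (\<phi> (gauss_map N x) * g x) \<partial>gauss_measure N) =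
    (\<integral>\<^sup>+x. ennreal (\<phi> x * transfer_op N g x) \<partial>gauss_measure N)"
proof -
  have [measurable]: "transfer_op N g \<in> borel_measurable borel" by (rule transfer_measurable) simp
  let ?F = "\<lambda>x. gauss_density N x * (\<phi> (gauss_map N x) * g x)"
  have "(\<integral>\<^sup>+x. ennreal (\<phi> (gauss_map N x) * g x) \<partial>gauss_measure N) =
    (\<integral>\<^sup>+y. (\<Sum>k. ennreal (?F (N / (real N + real k + y)) * (N / (real N + real k + y)\<^sup>2)
        * indicator {0..<1} y)) \<partial>lborel)"
    by (subst nn_integral_gauss_measure[OF N], simp) (rule nn_integral_unit_branches[OF N], simp)
  also have "\<dots> = (\<integral>\<^sup>+y. ennreal (gauss_density N y * (\<phi> y * transfer_op N g y) * indicator {0..<1} y) \<partial>lborel)"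
  proof (intro nn_integral_cong)
    fix y :: real
    show "(\<Sum>k. ennreal (?F (N / (real N + real k + y)) * (N / (real N + real k + y)\<^sup>2)
        * indicator {0..<1} y)) = ennreal (gauss_density N y * (\<phi> y * transfer_op N g y) * indicator {0..<1} y)"
    proof (cases "y \<in> {0..<1}")
      case True
      then have y: "y \<in> {0..1}" by auto
      let ?t = "\<lambda>k. gauss_density N y * \<phi> y * (branch_weight N k y * g (N / (real N + real k + y)))"
      have "?F (N / (real N + real k + y)) * (N / (real N + real k + y)\<^sup>2) = ?t k" for k
        using gauss_density_branch[OF N True, of k] by (simp add: gauss_map_branch[OF N True] mult_ac)
      then have "(\<Sum>k. ennreal (?F (N / (real N + real k + y)) * (N / (real N + real k + y)\<^sup>2)
        * indicator {0..<1} y)) = (\<Sum>k. ennreal (?t k))"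
        using True by simp
      also have "\<dots> = ennreal (gauss_density N y * \<phi> y * transfer_op N g y)"
      proof -
        have sums: "?t sums (gauss_density N y * \<phi> y * transfer_op N g y)"
          by (intro sums_mult transfer_sums N y g)
        have "?t k \<ge> 0" for k
          using gauss_density_pos[OF N, of y] y \<phi>[of y] branch_weight_nonneg[OF N y, of k]
            g[OF inverse_branch_in_unit[OF N y, of k]] by simp
        then show ?thesis
          using sums by (subst suminf_ennreal2) (auto simp: sums_iff)
      qed
      finally show ?thesis using True by (simp add: mult.assoc)
    qed simp
  qed
  also have "\<dots> = (\<integral>\<^sup>+x. ennreal (\<phi> x * transfer_op N g x) \<partial>gauss_measure N)"
    by (subst nn_integral_gauss_measure[OF N]) simp_all
  finally show ?thesis .
qed

section \<open>Asymptotic independence of a sequence of events\<close>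

text \<open>
  For \<open>f\<close> the indicator of an event \<open>B\<close> in a probability space this says that the measure of
  \<open>E n \<inter> B\<close> tends to \<open>c\<close> times that of \<open>B\<close>. The functions \<open>f\<close> with this property form a closed
  subspace of \<open>L\<^sup>1\<close>.
\<close>

definition mixes_with :: "'a measure \<Rightarrow> (nat \<Rightarrow> 'a set) \<Rightarrow> real \<Rightarrow> ('a \<Rightarrow> real) \<Rightarrow> bool" where
  "mixes_with M E c f \<longleftrightarrow> integrable M f \<and>
     (\<lambda>n. \<integral>x. indicator (E n) x * f x \<partial>M) \<longlonglongrightarrow> c * (\<integral>x. f x \<partial>M)"

lemma mixes_with_cong:
  assumes "\<And>x. x \<in> space M \<Longrightarrow> f x = g x"
  shows "mixes_with M E c f \<longleftrightarrow> mixes_with M E c g"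
proof -
  have "(\<integral>x. h x * f x \<partial>M) = (\<integral>x. h x * g x \<partial>M)" for h :: "_ \<Rightarrow> real"
    by (intro Bochner_Integration.integral_cong refl) (simp add: assms)
  moreover have "(\<integral>x. f x \<partial>M) = (\<integral>x. g x \<partial>M)"
    by (intro Bochner_Integration.integral_cong refl assms)
  moreover have "integrable M f \<longleftrightarrow> integrable M g"
    by (intro Bochner_Integration.integrable_cong refl assms)
  ultimately show ?thesis by (simp add: mixes_with_def)
qed

lemma mixes_with_add:
  assumes E: "\<And>n. E n \<in> sets M" and "mixes_with M E c f" "mixes_with M E c g"
  shows "mixes_with M E c (\<lambda>x. f x + g x)"
proof -
  have "integrable M (\<lambda>x. indicator (E n) x * f x)" "integrable M (\<lambda>x. indicator (E n) x * g x)" for n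
    using assms by (auto intro!: integrable_real_mult_indicator simp: mixes_with_def mult.commute)
  then show ?thesis
    using assms(2,3) by (auto simp: mixes_with_def distrib_left intro!: tendsto_add)
qed

lemma mixes_with_cmult:
  assumes "mixes_with M E c f"
  shows "mixes_with M E c (\<lambda>x. r * f x)"
proof -
  have "(\<lambda>n. r * (\<integral>x. indicator (E n) x * f x \<partial>M)) \<longlonglongrightarrow> r * (c * (\<integral>x. f x \<partial>M))"
    using assms by (intro tendsto_mult_left) (simp add: mixes_with_def)
  then show ?thesis
    using assms by (simp add: mixes_with_def mult.left_commute[of _ r])
qed

text \<open>
  Passing from \<open>s m\<close> to \<open>f\<close> changes the integral over \<open>E n\<close> by at most the \<open>L\<^sup>1\<close> distance of \<open>s m\<close>
  and \<open>f\<close>, whatever \<open>n\<close> is. This uniformity allows the limits in \<open>m\<close> and \<open>n\<close> to be exchanged.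
\<close>

lemma mixes_with_limit:
  assumes E: "\<And>n. E n \<in> sets M" and s: "\<And>m. mixes_with M E c (s m)"
    and f: "f \<in> borel_measurable M" and w: "integrable M w"
    and bound: "\<And>m x. x \<in> space M \<Longrightarrow> \<bar>s m x\<bar> \<le> w x"
    and lim: "\<And>x. x \<in> space M \<Longrightarrow> (\<lambda>m. s m x) \<longlonglongrightarrow> f x"
  shows "mixes_with M E c f"
proof -
  have s_int: "integrable M (s m)" for m using s by (simp add: mixes_with_def)
  have f_int: "integrable M f"
    by (rule integrable_dominated_convergence[OF f _ w, where s = s])
       (use s_int lim bound in auto)
  have s_lim: "(\<lambda>m. \<integral>x. s m x \<partial>M) \<longlonglongrightarrow> (\<integral>x. f x \<partial>M)"
    by (rule integral_dominated_convergence[OF f _ w])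
       (use s_int lim bound in auto)
  have L1: "(\<lambda>m. \<integral>x. \<bar>s m x - f x\<bar> \<partial>M) \<longlonglongrightarrow> (\<integral>x. 0 \<partial>M)"
  proof (rule integral_dominated_convergence)
    show "integrable M (\<lambda>x. w x + \<bar>f x\<bar>)" using w f_int by auto
    show "AE x in M. (\<lambda>m. \<bar>s m x - f x\<bar>) \<longlonglongrightarrow> 0"
      using lim by (intro AE_I2 tendsto_rabs_zero LIM_zero)
    show "AE x in M. norm \<bar>s m x - f x\<bar> \<le> w x + \<bar>f x\<bar>" for m
      using bound[of _ m] by (intro AE_I2) (fastforce)
  qed (use s_int f in auto)
  have ind_int: "integrable M (\<lambda>x. indicator (E n) x * h x)" if "integrable M h" for h :: "_ \<Rightarrow> real" and n
    using E that by (auto intro!: integrable_real_mult_indicator simp: mult.commute)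
  have close: "\<bar>(\<integral>x. indicator (E n) x * s m x \<partial>M) - (\<integral>x. indicator (E n) x * f x \<partial>M)\<bar>
      \<le> (\<integral>x. \<bar>s m x - f x\<bar> \<partial>M)" for m n
  proof -
    have "\<bar>(\<integral>x. indicator (E n) x * s m x \<partial>M) - (\<integral>x. indicator (E n) x * f x \<partial>M)\<bar>
        = \<bar>\<integral>x. indicator (E n) x * (s m x - f x) \<partial>M\<bar>"
      using ind_int[OF s_int] ind_int[OF f_int] by (simp add: right_diff_distrib)
    also have "\<dots> \<le> (\<integral>x. \<bar>indicator (E n) x * (s m x - f x)\<bar> \<partial>M)"
      by (rule integral_abs_bound)
    also have "\<dots> \<le> (\<integral>x. \<bar>s m x - f x\<bar> \<partial>M)"
      using s_int f_int
      by (intro integral_mono integrable_abs ind_int Bochner_Integration.integrable_diff)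
         (auto simp: indicator_def)
    finally show ?thesis .
  qed
  have "uniform_limit UNIV (\<lambda>m n. \<integral>x. indicator (E n) x * s m x \<partial>M)
      (\<lambda>n. \<integral>x. indicator (E n) x * f x \<partial>M) sequentially"
  proof (rule uniform_limitI)
    fix e :: real assume "e > 0"
    have "\<forall>\<^sub>F m in sequentially. (\<integral>x. \<bar>s m x - f x\<bar> \<partial>M) < e"
      using L1 \<open>e > 0\<close> by (intro order_tendstoD(2)[where y = 0]) simp_all
    then show "\<forall>\<^sub>F m in sequentially. \<forall>n\<in>UNIV.
        dist (\<integral>x. indicator (E n) x * s m x \<partial>M) (\<integral>x. indicator (E n) x * f x \<partial>M) < e"
      by eventually_elim (use close in \<open>auto simp: dist_real_def intro: le_less_trans\<close>)
  qed
  then have "(\<lambda>n. \<integral>x. indicator (E n) x * f x \<partial>M) \<longlonglongrightarrow> c * (\<integral>x. f x \<partial>M)"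
    by (rule swap_uniform_limit'[rotated 2])
       (use s in \<open>auto simp: mixes_with_def intro!: tendsto_mult_left s_lim\<close>)
  with f_int show ?thesis by (simp add: mixes_with_def)
qed

text \<open>
  The sets whose indicators have the property form a Dynkin system: complements use additivity
  together with the case of the whole space, and disjoint unions are bounded limits of finite sums.
\<close>

lemma mixes_with_indicator_sigma_sets:
  assumes "finite_measure M" and E: "\<And>n. E n \<in> sets M"
    and G: "Int_stable G" "G \<subseteq> Pow (space M)" "sets M = sigma_sets (space M) G"
    and mix: "\<And>B. B \<in> G \<Longrightarrow> mixes_with M E c (indicator B)"
    and top: "mixes_with M E c (indicator (space M))"
    and B: "B \<in> sets M"
  shows "mixes_with M E c (indicator B)"
  using G(1,2) B[unfolded G(3)]
proof (induction rule: sigma_sets_induct_disjoint)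
  case (basic A)
  then show ?case by (rule mix)
next
  case empty
  show ?case by (simp add: mixes_with_def)
next
  case (compl A)
  have "A \<subseteq> space M" using compl(1) G(3) sets.sets_into_space by blast
  then have "indicator (space M - A) = (\<lambda>x. indicator (space M) x + (-1) * indicator A x :: real)"
    by (auto simp: indicator_def fun_eq_iff)
  then show ?case
    using mixes_with_add[OF E top mixes_with_cmult[OF compl(2), of "-1"]] by simp
next
  case (union A)
  interpret finite_measure M by fact
  have A: "A i \<in> sets M" for i using union(2) G(3) by auto
  have partial: "mixes_with M E c (\<lambda>x. \<Sum>i<m. indicator (A i) x)" for m
  proof (induction m)
    case (Suc m)
    from mixes_with_add[OF E this union(3)[of m]] show ?case by (simp add: add_ac)
  qed (simp add: mixes_with_def)
  have eq: "(\<Sum>i<m. indicator (A i) x) = (indicator (\<Union>i<m. A i) x :: real)" for m x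
    by (rule indicator_UN_disjoint[symmetric])
       (use union(1) in \<open>simp_all add: disjoint_family_on_def\<close>)
  show ?case
  proof (rule mixes_with_limit[OF E partial])
    show "indicator (\<Union>i. A i) \<in> borel_measurable M" using A by auto
    show "integrable M (\<lambda>_. 1 :: real)" by simp
    show "\<bar>\<Sum>i<m. indicator (A i) x\<bar> \<le> (1::real)" for m x
      unfolding eq by simp
    show "(\<lambda>m. \<Sum>i<m. indicator (A i) x) \<longlonglongrightarrow> (indicator (\<Union>i. A i) x :: real)" for x
      unfolding eq by (rule LIMSEQ_indicator_UN)
  qed
qed

lemma mixes_with_integrable:
  assumes E: "\<And>n. E n \<in> sets M"
    and mix: "\<And>B. B \<in> sets M \<Longrightarrow> mixes_with M E c (indicator B)"
    and f: "integrable M f"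
  shows "mixes_with M E c f"
  using f
proof (induction rule: integrable_induct)
  case (base A r)
  show ?case using mixes_with_cmult[OF mix[OF base(1)], of r] by (simp add: mult.commute)
next
  case (add f g)
  then show ?case by (intro mixes_with_add E)
next
  case (lim f s)
  show ?case
    by (rule mixes_with_limit[OF E lim.IH, where w = "\<lambda>x. 2 * \<bar>f x\<bar>"]) (use lim in auto)
qed

text \<open>
  One step of duality applied to \<open>\<phi> \<circ> T\<^sup>n\<close> replaces \<open>g\<close> by its transform, hence the induction
  generalises over \<open>g\<close>.
\<close>

lemma transfer_iterate_dual:
  assumes N: "N \<ge> 1" and \<phi>: "\<phi> \<in> borel_measurable borel" "\<And>x. \<phi> x \<ge> 0"
    and g: "g \<in> borel_measurable borel" "\<And>y. y \<in> {0..1} \<Longrightarrow> g y \<in> {0..1}"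
  shows "(\<integral>\<^sup>+x. ennreal (\<phi> ((gauss_map N ^^ n) x) * g x) \<partial>gauss_measure N) =
    (\<integral>\<^sup>+x. ennreal (\<phi> x * (transfer_op N ^^ n) g x) \<partial>gauss_measure N)"
  using g
proof (induction n arbitrary: g)
  case (Suc n)
  have [measurable]: "gauss_map N ^^ n \<in> borel_measurable borel"
    by (induction n) (auto simp: id_def)
  note [measurable] = \<phi>(1)
  have "(\<integral>\<^sup>+x. ennreal (\<phi> ((gauss_map N ^^ Suc n) x) * g x) \<partial>gauss_measure N) =
     (\<integral>\<^sup>+x. ennreal ((\<lambda>z. \<phi> ((gauss_map N ^^ n) z)) (gauss_map N x) * g x) \<partial>gauss_measure N)"
    by (simp add: funpow_swap1)
  also have "\<dots> = (\<integral>\<^sup>+x. ennreal (\<phi> ((gauss_map N ^^ n) x) * transfer_op N g x) \<partial>gauss_measure N)"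
    using \<phi>(2) by (intro transfer_dual N Suc.prems) measurable
  also have "\<dots> = (\<integral>\<^sup>+x. ennreal (\<phi> x * (transfer_op N ^^ n) (transfer_op N g) x) \<partial>gauss_measure N)"
    by (intro Suc.IH transfer_measurable transfer_in_unit N Suc.prems)
  finally show ?case by (simp add: funpow_swap1)
qed simp

text \<open>
  Duality with \<open>g = 1\<close>, which the transfer operator fixes.
\<close>

lemma invariant_gauss_measure:
  assumes N: "N \<ge> 1"
  shows "invariant_measure (gauss_map N) (gauss_measure N)"
  unfolding invariant_measure_def
proof (intro conjI ballI gauss_map_measurable)
  fix A assume A: "A \<in> sets (gauss_measure N)"
  then have A': "A \<in> sets borel"
    by (auto simp: sets_gauss_measure leb_I_def sets_restrict_space)
  have TA: "gauss_map N -` A \<inter> space (gauss_measure N) \<in> sets (gauss_measure N)"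
    using A gauss_map_measurable by (rule measurable_sets[rotated])
  have "emeasure (gauss_measure N) (gauss_map N -` A \<inter> space (gauss_measure N)) =
      (\<integral>\<^sup>+x. indicator (gauss_map N -` A \<inter> space (gauss_measure N)) x \<partial>gauss_measure N)"
    using TA by simp
  also have "\<dots> = (\<integral>\<^sup>+x. ennreal (indicator A (gauss_map N x) * 1) \<partial>gauss_measure N)"
    by (intro nn_integral_cong) (auto simp: indicator_def)
  also have "\<dots> = (\<integral>\<^sup>+x. ennreal (indicator A x * transfer_op N (\<lambda>_. 1) x) \<partial>gauss_measure N)"
    using A' by (intro transfer_dual N) auto
  also have "\<dots> = (\<integral>\<^sup>+x. indicator A x \<partial>gauss_measure N)"
    by (intro nn_integral_cong) (auto simp: transfer_one[OF N] indicator_def)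
  also have "\<dots> = emeasure (gauss_measure N) A" using A by simp
  finally show "emeasure (gauss_measure N) (gauss_map N -` A \<inter> space (gauss_measure N)) =
      emeasure (gauss_measure N) A" .
qed

section \<open>Mixing of the Gauss map\<close>

lemma unit_osc_deviation:
  assumes "unit_osc r g" "x \<in> {0..1}"
  shows "\<bar>g x - g 0\<bar> \<le> r"
  using assms monotone_onD[of "{0..1}" "(\<le>)" "(\<le>)" g 0 x] monotone_onD[of "{0..1}" "(\<le>)" "(\<le>)" g x 1]
    monotone_onD[of "{0..1}" "(\<le>)" "(\<ge>)" g 0 x] monotone_onD[of "{0..1}" "(\<le>)" "(\<ge>)" g x 1]
  by (auto simp: unit_osc_def)

lemma funpow_measurable:
  assumes "T \<in> M \<rightarrow>\<^sub>M M"
  shows "T ^^ n \<in> M \<rightarrow>\<^sub>M M"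
  using assms by (induction n) auto

definition preimages :: "nat \<Rightarrow> real set \<Rightarrow> nat \<Rightarrow> real set" where
  "preimages N A n = (gauss_map N ^^ n) -` A \<inter> {0..<1}"

lemma preimages_sets:
  assumes "A \<in> sets (gauss_measure N)"
  shows "preimages N A n \<in> sets (gauss_measure N)"
  using measurable_sets[OF funpow_measurable[OF gauss_map_measurable] assms, of n]
  by (simp add: preimages_def)

text \<open>
  By duality the integral of \<open>g\<close> over the \<open>n\<close>-th preimage of \<open>A\<close> is the integral over \<open>A\<close> of the
  \<open>n\<close>-th transform of \<open>g\<close>, a function within \<open>(1 / (N + 1))\<^sup>n\<close> of its value at 0. For \<open>A\<close> the whole
  space the same estimate shows that this value is close to \<open>\<integral> g dM\<close>.
\<close>

lemma mixes_with_unit_osc: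
  assumes N: "N \<ge> 1" and g: "unit_osc 1 g" and A: "A \<in> sets (gauss_measure N)"
  shows "mixes_with (gauss_measure N) (preimages N A) (measure (gauss_measure N) A) g"
proof -
  let ?M = "gauss_measure N"
  interpret prob_space ?M by (rule prob_space_gauss_measure[OF N])
  define G where "G = (\<lambda>n. (transfer_op N ^^ n) g)"
  define r where "r = 1 / (real N + 1)"
  have r: "0 \<le> r" "r < 1" using N by (auto simp: r_def)
  have G: "unit_osc (r ^ n) (G n)" for n
    unfolding G_def r_def by (rule unit_osc_transfer_iterate[OF N g])
  have A': "A \<in> sets borel"
    using A by (auto simp: sets_gauss_measure leb_I_def sets_restrict_space)
  have unit: "\<And>y. y \<in> {0..1} \<Longrightarrow> h y \<in> {0..1}" "h \<in> borel_measurable borel" if "unit_osc r h" for r h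
    using that by (auto simp: unit_osc_def)
  have int: "integrable ?M (\<lambda>x. indicator S x * h x)"
    if "unit_osc q h" "S \<in> sets ?M" for q S h
  proof (intro integrable_const_bound[where B = 1] AE_I2)
    show "norm (indicator S x * h x) \<le> 1" if "x \<in> space ?M" for x
      using that unit(1)[OF \<open>unit_osc q h\<close>, of x] by (auto simp: indicator_def)
    show "(\<lambda>x. indicator S x * h x) \<in> borel_measurable ?M"
      using that unit[OF \<open>unit_osc q h\<close>]
      by (intro borel_measurable_times borel_measurable_indicator borel_measurable_gauss_measure)
  qed
  have dual: "(\<integral>x. indicator (preimages N S n) x * g x \<partial>?M) = (\<integral>x. indicator S x * G n x \<partial>?M)"
    if S: "S \<in> sets ?M" for S n
  proof -
    have S': "S \<in> sets borel"
      using S by (auto simp: sets_gauss_measure leb_I_def sets_restrict_space)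
    have "(\<integral>x. indicator (preimages N S n) x * g x \<partial>?M) =
        enn2real (\<integral>\<^sup>+x. ennreal (indicator (preimages N S n) x * g x) \<partial>?M)"
      using int[OF g preimages_sets[OF S]] unit[OF g]
      by (intro integral_eq_nn_integral) auto
    also have "(\<integral>\<^sup>+x. ennreal (indicator (preimages N S n) x * g x) \<partial>?M) =
        (\<integral>\<^sup>+x. ennreal (indicator S ((gauss_map N ^^ n) x) * g x) \<partial>?M)"
      by (intro nn_integral_cong) (auto simp: preimages_def indicator_def)
    also have "\<dots> = (\<integral>\<^sup>+x. ennreal (indicator S x * G n x) \<partial>?M)"
      unfolding G_def using S' unit[OF g] by (intro transfer_iterate_dual N) auto
    also have "enn2real \<dots> = (\<integral>x. indicator S x * G n x \<partial>?M)"
      using int[OF G S] unit[OF G]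
      by (intro integral_eq_nn_integral[symmetric]) auto
    finally show ?thesis .
  qed
  have near: "\<bar>(\<integral>x. indicator S x * G n x \<partial>?M) - G n 0 * prob S\<bar> \<le> r ^ n"
    if S: "S \<in> sets ?M" for S n
  proof -
    have "S \<inter> {0..<1} = S" using sets.sets_into_space[OF S] by auto
    then have "(\<integral>x. indicator S x * G n x \<partial>?M) - G n 0 * prob S =
        (\<integral>x. indicator S x * (G n x - G n 0) \<partial>?M)"
      using int[OF G S] S by (simp add: right_diff_distrib emeasure_eq_measure)
    moreover have int_dev: "integrable ?M (\<lambda>x. indicator S x * (G n x - G n 0))"
      using int[OF G S] S by (simp add: right_diff_distrib emeasure_eq_measure)
    have dev: "\<bar>indicator S x * (G n x - G n 0)\<bar> \<le> r ^ n" if "x \<in> space ?M" for x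
      using unit_osc_deviation[OF G, of x n] that r by (auto simp: indicator_def)
    moreover have "AE x in ?M. indicator S x * (G n x - G n 0) \<le> r ^ n"
      "AE x in ?M. - (r ^ n) \<le> indicator S x * (G n x - G n 0)"
      using dev by (auto simp: abs_le_iff minus_le_iff)
    ultimately show ?thesis
      using integral_le_const[of "\<lambda>x. indicator S x * (G n x - G n 0)" "r ^ n"]
        integral_ge_const[of "\<lambda>x. indicator S x * (G n x - G n 0)" "- (r ^ n)"]
      int_dev
      by (simp add: abs_le_iff)
  qed
  have g_int: "(\<integral>x. g x \<partial>?M) = (\<integral>x. indicator (space ?M) x * G n x \<partial>?M)" for n
  proof -
    have "(gauss_map N ^^ n) x \<in> {0..<1}" if "x \<in> {0..<1}" for x
      using measurable_space[OF funpow_measurable[OF gauss_map_measurable], of x N n] that by simp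
    then have "(\<integral>x. g x \<partial>?M) = (\<integral>x. indicator (preimages N (space ?M) n) x * g x \<partial>?M)"
      by (intro Bochner_Integration.integral_cong) (auto simp: preimages_def)
    then show ?thesis using dual[OF sets.top] by simp
  qed
  have bound: "\<bar>(\<integral>x. indicator (preimages N A n) x * g x \<partial>?M) - prob A * (\<integral>x. g x \<partial>?M)\<bar> \<le> 2 * r ^ n" for n
  proof -
    have "\<bar>(\<integral>x. g x \<partial>?M) - G n 0\<bar> \<le> r ^ n"
      using near[OF sets.top, of n] g_int[of n] prob_space by simp
    then have "prob A * \<bar>(\<integral>x. g x \<partial>?M) - G n 0\<bar> \<le> 1 * r ^ n"
      by (intro mult_mono) auto
    moreover have "prob A * (\<integral>x. g x \<partial>?M) - G n 0 * prob A = prob A * ((\<integral>x. g x \<partial>?M) - G n 0)"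
      by (simp add: algebra_simps)
    ultimately have "\<bar>prob A * (\<integral>x. g x \<partial>?M) - G n 0 * prob A\<bar> \<le> r ^ n"
      by (simp add: abs_mult)
    then show ?thesis
      using near[OF A, of n] unfolding dual[OF A] by linarith
  qed
  have "(\<lambda>n. 2 * r ^ n) \<longlonglongrightarrow> 2 * 0"
    by (intro tendsto_mult_left LIMSEQ_power_zero) (use r in auto)
  then have "(\<lambda>n. 2 * r ^ n) \<longlonglongrightarrow> 0" by simp
  then have "(\<lambda>n. (\<integral>x. indicator (preimages N A n) x * g x \<partial>?M) - prob A * (\<integral>x. g x \<partial>?M)) \<longlonglongrightarrow> 0"
    by (rule Lim_null_comparison[rotated]) (use bound in auto)
  then have "(\<lambda>n. \<integral>x. indicator (preimages N A n) x * g x \<partial>?M) \<longlonglongrightarrow> prob A * (\<integral>x. g x \<partial>?M)"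
    by (rule LIM_zero_cancel)
  moreover have "integrable ?M g"
    using unit[OF g] by (intro integrable_const_bound[where B = 1] AE_I2 borel_measurable_gauss_measure) auto
  ultimately show ?thesis by (simp add: mixes_with_def)
qed

text \<open>
  Indicators of rays are monotone, and the traces of rays on \<open>[0,1)\<close> form an intersection-stable
  generator of its Borel sets.
\<close>

lemma gauss_map_mixing:
  assumes N: "N \<ge> 1" and A: "A \<in> sets (gauss_measure N)" and f: "integrable (gauss_measure N) f"
  shows "mixes_with (gauss_measure N) (preimages N A) (measure (gauss_measure N) A) f"
proof -
  let ?M = "gauss_measure N"
  let ?G = "range (\<lambda>t::real. {0..<1} \<inter> {t..})"
  interpret prob_space ?M by (rule prob_space_gauss_measure[OF N])
  note E = preimages_sets[OF A]
  have ray: "mixes_with ?M (preimages N A) (prob A) (indicator ({0..<1} \<inter> {t..}))" for t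
  proof -
    have "unit_osc 1 (indicator {t..})"
      by (auto simp: unit_osc_def monotone_on_def indicator_def)
    from mixes_with_unit_osc[OF N this A]
    have "mixes_with ?M (preimages N A) (prob A) (indicator {t..})" .
    then show ?thesis
      by (subst mixes_with_cong[where g = "indicator {t..}"]) (auto simp: indicator_def)
  qed
  have borel: "sets borel = sigma_sets UNIV (range (atLeast :: real \<Rightarrow> _))"
    by (subst borel_Ici) simp
  have "sets ?M = (\<inter>) {0..<1} ` sigma_sets UNIV (range atLeast)"
    by (simp add: sets_gauss_measure leb_I_def sets_restrict_space borel)
  also have "\<dots> = sigma_sets {0..<1} ((\<inter>) {0..<1} ` range atLeast)"
    by (rule sigma_sets_Int) (simp_all flip: borel)
  finally have gen: "sets ?M = sigma_sets (space ?M) ?G"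
    by (simp add: image_image)
  have "mixes_with ?M (preimages N A) (prob A) (indicator B)" if "B \<in> sets ?M" for B
  proof (rule mixes_with_indicator_sigma_sets[OF _ E _ _ gen _ _ that])
    show "Int_stable ?G"
    proof (rule Int_stableI)
      fix a b assume "a \<in> ?G" "b \<in> ?G"
      then obtain s t where "a = {0..<1} \<inter> {s..}" "b = {0..<1} \<inter> {t..}" by auto
      then have "a \<inter> b = {0..<1} \<inter> {max s t..}" by auto
      then show "a \<inter> b \<in> ?G" by blast
    qed
    show "mixes_with ?M (preimages N A) (prob A) (indicator (space ?M))"
      using ray[of 0] by (simp add: Int_absorb2 subset_iff)
  qed (use ray finite_measure_axioms in auto)
  then show ?thesis
    by (rule mixes_with_integrable[OF E _ f])
qed

section \<open>Ergodicity and uniqueness\<close>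

text \<open>
  An invariant set equals all its preimages, so mixing makes it independent of itself.
\<close>

lemma ergodic_gauss_measure:
  assumes N: "N \<ge> 1"
  shows "ergodic_measure (gauss_map N) (gauss_measure N)"
  unfolding ergodic_measure_def
proof (intro ballI impI)
  let ?M = "gauss_measure N"
  interpret prob_space ?M by (rule prob_space_gauss_measure[OF N])
  fix A assume A: "A \<in> sets ?M" and inv: "gauss_map N -` A \<inter> space ?M = A"
  have pre: "preimages N A n = A" for n
  proof (induction n)
    case 0
    show ?case using sets.sets_into_space[OF A] by (auto simp: preimages_def)
  next
    case (Suc n)
    have "preimages N A (Suc n) = gauss_map N -` (preimages N A n) \<inter> space ?M"
      using measurable_space[OF gauss_map_measurable, of _ N]
      by (auto simp: preimages_def funpow_swap1)
    then show ?case using Suc inv by simp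
  qed
  have [simp]: "A \<inter> {0..<1} = A" using sets.sets_into_space[OF A] by auto
  have "integrable ?M (indicator A :: real \<Rightarrow> real)" using A by (simp add: emeasure_eq_measure)
  from gauss_map_mixing[OF N A this]
  have "(\<lambda>n::nat. prob A) \<longlonglongrightarrow> prob A * prob A"
    using A by (simp add: mixes_with_def pre flip: indicator_inter_arith)
  then have "prob A = prob A * prob A" by (simp add: tendsto_const_iff)
  then have "prob A = 0 \<or> prob A = 1" by simp
  then show "emeasure ?M A = 0 \<or> emeasure ?M (space ?M - A) = 0"
    using prob_compl[OF A] by (auto simp: emeasure_eq_measure)
qed

lemma absolutely_continuous_gauss_measure: "absolutely_continuous leb_I (gauss_measure N)"
  unfolding gauss_measure_def
  by (intro absolutely_continuousI_density borel_measurable_leb_I) measurable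

text \<open>
  The Gauss density is strictly positive on \<open>[0,1)\<close>, so the Gauss measure and Lebesgue measure have
  the same null sets; this provides the density of \<open>\<mu>\<close> relative to the Gauss measure.
\<close>

lemma absolutely_continuous_gauss_measure_iff:
  assumes N: "N \<ge> 1"
  shows "absolutely_continuous (gauss_measure N) \<mu> \<longleftrightarrow> absolutely_continuous leb_I \<mu>"
proof -
  have "null_sets (gauss_measure N) = null_sets leb_I"
  proof (intro set_eqI)
    fix A
    have [measurable]: "(\<lambda>x. ennreal (gauss_density N x)) \<in> borel_measurable leb_I"
      by (rule borel_measurable_leb_I) measurable
    have pos: "ennreal (gauss_density N x) \<noteq> 0" if "x \<in> space leb_I" for x
      using gauss_density_pos[OF N, of x] that by (simp add: leb_I_def space_restrict_space)
    have "A \<in> null_sets (gauss_measure N) \<longleftrightarrow>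
        A \<in> sets leb_I \<and> (AE x in leb_I. x \<in> A \<longrightarrow> ennreal (gauss_density N x) = 0)"
      unfolding gauss_measure_def gauss_density_def[symmetric]
      by (rule null_sets_density_iff) simp
    also have "\<dots> \<longleftrightarrow> A \<in> sets leb_I \<and> (AE x in leb_I. x \<notin> A)"
      by (intro conj_cong refl AE_cong) (simp add: pos)
    also have "\<dots> \<longleftrightarrow> A \<in> null_sets leb_I" using AE_iff_null_sets[of A leb_I] by blast
    finally show "A \<in> null_sets (gauss_measure N) \<longleftrightarrow> A \<in> null_sets leb_I" .
  qed
  then show ?thesis by (simp add: absolutely_continuous_def)
qed

lemma invariant_measure_funpow:
  assumes inv: "invariant_measure T M" and A: "A \<in> sets M"
  shows "emeasure M ((T ^^ n) -` A \<inter> space M) = emeasure M A"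
proof (induction n)
  case 0
  show ?case using sets.sets_into_space[OF A] by (simp add: Int_absorb2)
next
  case (Suc n)
  have T: "T \<in> M \<rightarrow>\<^sub>M M" using inv by (simp add: invariant_measure_def)
  have "(T ^^ Suc n) -` A \<inter> space M = T -` ((T ^^ n) -` A \<inter> space M) \<inter> space M"
    using measurable_space[OF T] by (auto simp: funpow_swap1)
  also have "emeasure M \<dots> = emeasure M ((T ^^ n) -` A \<inter> space M)"
    using inv measurable_sets[OF funpow_measurable[OF T] A, of n]
    unfolding invariant_measure_def by blast
  finally show ?case unfolding Suc.IH .
qed

text \<open>
  Mixing is applied to the density \<open>D\<close> of \<open>\<mu>\<close>: the integral of \<open>D\<close> over the \<open>n\<close>-th preimage of \<open>A\<close>
  is the \<open>\<mu>\<close>-measure of that preimage, which by invariance does not depend on \<open>n\<close>.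
\<close>

lemma gauss_measure_unique:
  assumes N: "N \<ge> 1" and sets: "sets \<mu> = sets leb_I" and "prob_space \<mu>"
    and inv: "invariant_measure (gauss_map N) \<mu>" and ac: "absolutely_continuous leb_I \<mu>"
  shows "\<mu> = gauss_measure N"
proof -
  let ?M = "gauss_measure N"
  interpret M: prob_space ?M by (rule prob_space_gauss_measure[OF N])
  interpret \<mu>: prob_space \<mu> by fact
  have ac': "absolutely_continuous ?M \<mu>" and sets': "sets \<mu> = sets ?M"
    using ac sets by (simp_all add: absolutely_continuous_gauss_measure_iff[OF N] sets_gauss_measure)
  have space': "space \<mu> = {0..<1}" using sets_eq_imp_space_eq[OF sets'] by simp
  obtain D where D: "D \<in> borel_measurable ?M" "AE x in ?M. RN_deriv ?M \<mu> x = ennreal (D x)" "\<And>x. 0 \<le> D x"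
    using M.real_RN_deriv[OF \<mu>.finite_measure_axioms ac' sets'] by blast
  have \<mu>: "\<mu> = density ?M (\<lambda>x. ennreal (D x))"
    using M.density_RN_deriv[OF ac' sets'] D density_cong[of "RN_deriv ?M \<mu>" ?M "\<lambda>x. ennreal (D x)"]
    by simp
  have measure_D: "\<mu>.prob B = (\<integral>x. indicator B x * D x \<partial>?M)" if B: "B \<in> sets ?M" for B
  proof -
    have "emeasure \<mu> B = (\<integral>\<^sup>+x. ennreal (indicator B x * D x) \<partial>?M)"
      using B D(1) by (subst \<mu>, subst emeasure_density) (auto intro!: nn_integral_cong simp: indicator_def)
    then show ?thesis
      using B D by (subst integral_eq_nn_integral) (auto simp: measure_def)
  qed
  have D_int: "integrable ?M D"
  proof (rule integrableI_nonneg)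
    have "(\<integral>\<^sup>+x. ennreal (D x) \<partial>?M) = (\<integral>\<^sup>+x. ennreal (D x) * indicator (space ?M) x \<partial>?M)"
      by (intro nn_integral_cong) simp
    also have "\<dots> = emeasure \<mu> (space ?M)"
      using D(1) sets.top[of ?M] by (subst \<mu>, subst emeasure_density) simp_all
    finally show "(\<integral>\<^sup>+x. ennreal (D x) \<partial>?M) < \<infinity>" by (simp add: \<mu>.emeasure_eq_measure)
  qed (use D in auto)
  have D_1: "(\<integral>x. D x \<partial>?M) = 1"
  proof -
    have "(\<integral>x. D x \<partial>?M) = (\<integral>x. indicator (space ?M) x * D x \<partial>?M)"
      by (intro Bochner_Integration.integral_cong) auto
    also have "\<dots> = 1" using measure_D[OF sets.top] \<mu>.prob_space space' by simp
    finally show ?thesis .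
  qed
  show ?thesis
  proof (rule measure_eqI[OF sets'])
    fix A assume "A \<in> sets \<mu>"
    then have A: "A \<in> sets ?M" using sets' by simp
    have "(\<integral>x. indicator (preimages N A n) x * D x \<partial>?M) = \<mu>.prob A" for n
      using measure_D[OF preimages_sets[OF A], of n] invariant_measure_funpow[OF inv \<open>A \<in> sets \<mu>\<close>, of n]
      by (simp add: preimages_def space' measure_def)
    then have "(\<lambda>n::nat. \<mu>.prob A) \<longlonglongrightarrow> M.prob A"
      using gauss_map_mixing[OF N A D_int] D_1 by (simp add: mixes_with_def)
    then have "\<mu>.prob A = M.prob A" by (simp add: tendsto_const_iff)
    then show "emeasure \<mu> A = emeasure ?M A"
      by (simp add: \<mu>.emeasure_eq_measure M.emeasure_eq_measure)
  qed
qed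

theorem theorem1p3:
  fixes N :: nat
  assumes "N \<ge> 1"
  shows "(\<exists>!\<mu>. acim_ergodic N \<mu>) \<and> acim_ergodic N (gauss_measure N)"
proof -
  have "acim_ergodic N (gauss_measure N)"
    unfolding acim_ergodic_def
    by (intro conjI sets_gauss_measure prob_space_gauss_measure invariant_gauss_measure
        ergodic_gauss_measure absolutely_continuous_gauss_measure assms)
  moreover have "\<mu> = gauss_measure N" if "acim_ergodic N \<mu>" for \<mu>
    using that gauss_measure_unique[OF assms] by (simp add: acim_ergodic_def)
  ultimately show ?thesis by blast
qed

end
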